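(* Let $T$ be a 1-dimensional complex triassociative algebra. Then $T$ is isomorphic to one of the following pairwise non-isomorphic triassociative algebras with basis $\{x\}$ (all non-specified products of basis elements being zero): \begin{enumerate} \item[] $Trias_1^1$: abelian (all three products are zero); \item[] $Trias_1^2$: $x\perp x = x$; \item[] $Trias_1^3$: $x\vdash x = x\dashv x = x\perp x = x$. \end{enumerate}
   Context: A (complex) triassociative algebra $(T,\vdash,\dashv,\perp)$ is a vector space $T$ over $\mathbb{C}$ equipped with three bilinear products $\vdash,\dashv,\perp: T\times T\to T$ satisfying, for all $x,y,z\in T$, the following 11 identities: (A1) $(x\vdash y)\vdash z = x\vdash(y\vdash z)$; (A2) $(x\dashv y)\dashv z = x\dashv(y\dashv z)$; (D1) $(x\dashv y)\vdash z = x\vdash(y\vdash z)$; (D2) $(x\dashv y)\dashv z = x\dashv(y\vdash z)$; (S1) $(x\vdash y)\dashv z = x\vdash(y\dashv z)$; (T1) $(x\perp y)\vdash z = x\vdash(y\vdash z)$; (T2) $(x\dashv y)\dashv z = x\dashv(y\perp z)$; (T3) $(x\vdash y)\perp z = x\vdash(y\perp z)$; (T4) $(x\perp y)\dashv z = x\perp(y\dashv z)$; (S2) $(x\dashv y)\perp z = x\perp(y\vdash z)$; (A3) $(x\perp y)\perp z = x\perp(y\perp z)$. An isomorphism of triassociative algebras is a linear bijection preserving all three products. Convention: in each listed algebra, all products of basis elements that are not specified are zero. *)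

theory Defs
  imports Complex_Main
begin

(* A type 'a :: ab_group_add with a complex scalar multiplication and three binary operations;
   the underlying vector space is the whole type. *)
record 'a trias =
  smult :: "complex \<Rightarrow> 'a \<Rightarrow> 'a"
  rprod :: "'a \<Rightarrow> 'a \<Rightarrow> 'a" (infixl "\<turnstile>\<index>" 70)
  lprod :: "'a \<Rightarrow> 'a \<Rightarrow> 'a" (infixl "\<stileturnstile>\<index>" 70)
  mprod :: "'a \<Rightarrow> 'a \<Rightarrow> 'a" (infixl "\<bottom>\<index>" 70)

definition bilinear_op :: "(complex \<Rightarrow> 'a \<Rightarrow> 'a) \<Rightarrow> ('a::ab_group_add \<Rightarrow> 'a \<Rightarrow> 'a) \<Rightarrow> bool" where
  "bilinear_op s p \<longleftrightarrow>
     (\<forall>x. Vector_Spaces.linear s s (\<lambda>y. p x y)) \<and> (\<forall>y. Vector_Spaces.linear s s (\<lambda>x. p x y))"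

locale triassociative_algebra =
  fixes T :: "'a::ab_group_add trias" (structure)
  assumes vector_space: "vector_space (smult T)"
    and bilinear_rprod: "bilinear_op (smult T) (rprod T)"
    and bilinear_lprod: "bilinear_op (smult T) (lprod T)"
    and bilinear_mprod: "bilinear_op (smult T) (mprod T)"
    and A1: "(x \<turnstile> y) \<turnstile> z = x \<turnstile> (y \<turnstile> z)"
    and A2: "(x \<stileturnstile> y) \<stileturnstile> z = x \<stileturnstile> (y \<stileturnstile> z)"
    and D1: "(x \<stileturnstile> y) \<turnstile> z = x \<turnstile> (y \<turnstile> z)"
    and D2: "(x \<stileturnstile> y) \<stileturnstile> z = x \<stileturnstile> (y \<turnstile> z)"
    and S1: "(x \<turnstile> y) \<stileturnstile> z = x \<turnstile> (y \<stileturnstile> z)"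
    and T1: "(x \<bottom> y) \<turnstile> z = x \<turnstile> (y \<turnstile> z)"
    and T2: "(x \<stileturnstile> y) \<stileturnstile> z = x \<stileturnstile> (y \<bottom> z)"
    and T3: "(x \<turnstile> y) \<bottom> z = x \<turnstile> (y \<bottom> z)"
    and T4: "(x \<bottom> y) \<stileturnstile> z = x \<bottom> (y \<stileturnstile> z)"
    and S2: "(x \<stileturnstile> y) \<bottom> z = x \<bottom> (y \<turnstile> z)"
    and A3: "(x \<bottom> y) \<bottom> z = x \<bottom> (y \<bottom> z)"

definition trias_dim :: "'a::ab_group_add trias \<Rightarrow> nat" where
  "trias_dim T = vector_space.dim (smult T) UNIV"

definition trias_basis :: "'a::ab_group_add trias \<Rightarrow> 'a set \<Rightarrow> bool" where
  "trias_basis T B \<longleftrightarrow> \<not> module.dependent (smult T) B \<and> module.span (smult T) B = UNIV"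

definition trias_iso :: "'a::ab_group_add trias \<Rightarrow> 'b::ab_group_add trias \<Rightarrow> ('a \<Rightarrow> 'b) \<Rightarrow> bool" where
  "trias_iso S T f \<longleftrightarrow>
     Vector_Spaces.linear (smult S) (smult T) f \<and> bij f \<and>
     (\<forall>x y. f (x \<turnstile>\<^bsub>S\<^esub> y) = f x \<turnstile>\<^bsub>T\<^esub> f y) \<and>
     (\<forall>x y. f (x \<stileturnstile>\<^bsub>S\<^esub> y) = f x \<stileturnstile>\<^bsub>T\<^esub> f y) \<and>
     (\<forall>x y. f (x \<bottom>\<^bsub>S\<^esub> y) = f x \<bottom>\<^bsub>T\<^esub> f y)"

definition trias_isomorphic :: "'a::ab_group_add trias \<Rightarrow> 'b::ab_group_add trias \<Rightarrow> bool" where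
  "trias_isomorphic S T \<longleftrightarrow> (\<exists>f. trias_iso S T f)"

(* The three algebras live on the complex line with basis vector x = 1. The product u * v is the
   bilinear extension of the rule that sends (x, x) to x. *)

definition Trias_1_1 :: "complex trias" where
  "Trias_1_1 =
     \<lparr>smult = (*), rprod = (\<lambda>u v. 0), lprod = (\<lambda>u v. 0), mprod = (\<lambda>u v. 0)\<rparr>"

definition Trias_1_2 :: "complex trias" where
  "Trias_1_2 =
     \<lparr>smult = (*), rprod = (\<lambda>u v. 0), lprod = (\<lambda>u v. 0), mprod = (\<lambda>u v. u * v)\<rparr>"

definition Trias_1_3 :: "complex trias" where
  "Trias_1_3 =
     \<lparr>smult = (*), rprod = (\<lambda>u v. u * v), lprod = (\<lambda>u v. u * v), mprod = (\<lambda>u v. u * v)\<rparr>"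

end

theory Submission
  imports Defs
begin

text \<open>
  On a line spanned by \<open>e\<close>, a bilinear product is determined by one scalar, its structure constant:
  let \<open>e \<turnstile> e = a e\<close>, \<open>e \<stileturnstile> e = b e\<close> and \<open>e \<bottom> e = c e\<close>. Evaluated at \<open>e\<close>, each identity of a
  triassociative algebra compares two monomials of degree two in \<open>a, b, c\<close>. From (D1) and (D2) one
  gets \<open>b a = a a\<close> and \<open>b b = b a\<close>, hence \<open>(b - a)\<^sup>2 = 0\<close> and \<open>a = b\<close>; from (T1) one gets
  \<open>c a = a a\<close>, so \<open>a = 0\<close> or \<open>c = a\<close>. This leaves the triples \<open>(0, 0, 0)\<close>, \<open>(0, 0, c)\<close> and
  \<open>(c, c, c)\<close> with \<open>c \<noteq> 0\<close> (lemma \<open>structure_constants\<close>), and replacing \<open>e\<close> by \<open>e / c\<close> makes the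
  remaining constant equal to one (lemma \<open>isomorphic_line_trias\<close>).

  The three algebras differ in which of their products vanish identically, and an isomorphism
  preserves that.
\<close>

section \<open>Triassociative structures on the complex line\<close>

definition line_trias :: "complex \<Rightarrow> complex \<Rightarrow> complex \<Rightarrow> complex trias" where
  "line_trias a b c =
     \<lparr>smult = (*), rprod = (\<lambda>u v. a * (u * v)), lprod = (\<lambda>u v. b * (u * v)),
      mprod = (\<lambda>u v. c * (u * v))\<rparr>"

lemma Trias_eq_line_trias:
  "Trias_1_1 = line_trias 0 0 0"
  "Trias_1_2 = line_trias 0 0 1"
  "Trias_1_3 = line_trias 1 1 1"
  by (simp_all add: Trias_1_1_def Trias_1_2_def Trias_1_3_def line_trias_def)

lemma vector_space_complex_times: "vector_space ((*) :: complex \<Rightarrow> complex \<Rightarrow> complex)"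
  by unfold_locales (simp_all add: algebra_simps)

lemma bilinear_op_complex_times: "bilinear_op (*) (\<lambda>u v. a * (u * v))"
  unfolding bilinear_op_def Vector_Spaces.linear_iff
  by (simp add: vector_space_complex_times algebra_simps)

text \<open>
  The condition is also necessary, by the computation in \<open>structure_constants\<close>.
\<close>
lemma triassociative_line_trias:
  assumes "a = 0 \<or> c = a"
  shows "triassociative_algebra (line_trias a a c)"
  using assms
  by (intro triassociative_algebra.intro)
    (auto simp: line_trias_def vector_space_complex_times bilinear_op_complex_times)

lemma trias_basis_line_trias: "trias_basis (line_trias a b c) {1}"
proof -
  interpret vector_space "(*) :: complex \<Rightarrow> complex \<Rightarrow> complex"
    by (rule vector_space_complex_times)
  have "span {1 :: complex} = UNIV"
    by (auto simp: span_singleton)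
  then show ?thesis
    by (simp add: trias_basis_def line_trias_def dependent_single)
qed

section \<open>Structure constants of a one-dimensional algebra\<close>

lemma one_dimensional_coordinate:
  fixes s :: "complex \<Rightarrow> 'a::ab_group_add \<Rightarrow> 'a"
  assumes "vector_space s" and "vector_space.dim s UNIV = 1"
  obtains e k where "e \<noteq> 0" and "\<And>x. s (k x) e = x"
proof -
  interpret vector_space s by fact
  obtain B where B: "independent B" "UNIV \<subseteq> span B" "card B = dim UNIV"
    using basis_exists[of UNIV] by blast
  have "card B = 1"
    using B(3) assms(2) by simp
  then obtain e where e: "B = {e}"
    by (rule card_1_singletonE)
  have "e \<noteq> 0"
    using B(1) e by (simp add: dependent_single)
  moreover have "\<exists>k. s k e = x" for x
  proof -
    have "x \<in> span {e}"
      using B(2) e by blast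
    then show ?thesis
      unfolding span_singleton by blast
  qed
  then have "s (SOME k. s k e = x) e = x" for x
    by (rule someI_ex)
  ultimately show thesis
    by (rule that)
qed

lemma bilinear_op_scale:
  assumes "bilinear_op s p"
  shows "p (s l x) (s m y) = s m (s l (p x y))"
  using assms by (simp add: bilinear_op_def Vector_Spaces.linear_iff)

lemma structure_constants:
  assumes "triassociative_algebra T" and "e \<noteq> 0"
    and r: "rprod T e e = smult T a e"
    and l: "lprod T e e = smult T b e"
    and m: "mprod T e e = smult T c e"
  shows "b = a" and "a = 0 \<or> c = a"
proof -
  interpret triassociative_algebra T by fact
  interpret V: vector_space "smult T" by (rule vector_space)
  have scale: "p (smult T k e) e = smult T k (p e e)" "p e (smult T k e) = smult T k (p e e)"
    if "bilinear_op (smult T) p" for p k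
    using that by (simp_all add: bilinear_op_def Vector_Spaces.linear_iff)
  have "b * a = a * a"
    using D1[of e e e] \<open>e \<noteq> 0\<close> by (simp add: r l scale bilinear_rprod)
  moreover have "b * b = b * a"
    using D2[of e e e] \<open>e \<noteq> 0\<close> by (simp add: r l scale bilinear_lprod mult.commute)
  ultimately show "b = a"
    by auto
  have "c * a = a * a"
    using T1[of e e e] \<open>e \<noteq> 0\<close> by (simp add: r m scale bilinear_rprod)
  then show "a = 0 \<or> c = a"
    by auto
qed

text \<open>
  The vector \<open>e / d\<close> has structure constants \<open>a\<close>, \<open>b\<close>, \<open>c\<close>, so the isomorphism is the coordinate
  with respect to \<open>e / d\<close>, which is \<open>d\<close> times the coordinate with respect to \<open>e\<close>.
\<close>
lemma isomorphic_line_trias: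
  assumes "triassociative_algebra T" and "e \<noteq> 0" and k: "\<And>x. smult T (k x) e = x"
    and r: "rprod T e e = smult T (d * a) e"
    and l: "lprod T e e = smult T (d * b) e"
    and m: "mprod T e e = smult T (d * c) e"
    and "d \<noteq> 0"
  shows "trias_isomorphic T (line_trias a b c)"
proof -
  interpret triassociative_algebra T by fact
  interpret V: vector_space "smult T" by (rule vector_space)
  have k_eq: "k x = z" if "x = smult T z e" for x z
    using k[of x] that \<open>e \<noteq> 0\<close> by simp
  have k_add: "k (x + y) = k x + k y" for x y
    by (rule k_eq) (simp add: V.scale_left_distrib k)
  have k_scale: "k (smult T z x) = z * k x" for x z
    by (rule k_eq) (simp add: V.scale_scale[symmetric] k del: V.scale_scale)
  have k_prod: "k (p x y) = k x * k y * z"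
    if "bilinear_op (smult T) p" and "p e e = smult T z e" for p x y z
  proof (rule k_eq)
    have "p (smult T (k x) e) (smult T (k y) e) = smult T (k x * k y * z) e"
      by (simp add: bilinear_op_scale[OF that(1)] that(2) ac_simps)
    then show "p x y = smult T (k x * k y * z) e"
      by (simp add: k)
  qed
  let ?f = "\<lambda>x. d * k x"
  have "bij ?f"
  proof (rule bijI)
    show "inj ?f"
    proof (rule injI)
      fix x y
      assume "d * k x = d * k y"
      then have "smult T (k x) e = smult T (k y) e"
        using \<open>d \<noteq> 0\<close> by simp
      then show "x = y"
        unfolding k .
    qed
    have "?f (smult T (z / d) e) = z" for z
      using k_eq[OF refl] \<open>d \<noteq> 0\<close> by simp
    then show "surj ?f"
      by (rule surjI)
  qed
  moreover have "Vector_Spaces.linear (smult T) (*) ?f"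
    by (simp add: Vector_Spaces.linear_iff vector_space vector_space_complex_times
        k_add k_scale algebra_simps)
  ultimately have "trias_iso T (line_trias a b c) ?f"
    by (simp add: trias_iso_def line_trias_def k_prod[OF bilinear_rprod r]
        k_prod[OF bilinear_lprod l] k_prod[OF bilinear_mprod m])
  then show ?thesis
    unfolding trias_isomorphic_def by blast
qed

lemma one_dimensional_classification:
  fixes T :: "'a::ab_group_add trias"
  assumes T: "triassociative_algebra T" and "trias_dim T = 1"
  shows "trias_isomorphic T Trias_1_1 \<or> trias_isomorphic T Trias_1_2 \<or> trias_isomorphic T Trias_1_3"
proof -
  interpret triassociative_algebra T by fact
  obtain e k where e: "e \<noteq> 0" and k: "\<And>x. smult T (k x) e = x"
    using one_dimensional_coordinate[OF vector_space assms(2)[unfolded trias_dim_def]] by blast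
  obtain a b c where r: "rprod T e e = smult T a e" and l: "lprod T e e = smult T b e"
    and m: "mprod T e e = smult T c e"
    using k[symmetric] by blast
  note iso = isomorphic_line_trias[OF T e k]
  have ba: "b = a" and ac: "a = 0 \<or> c = a"
    using structure_constants[OF T e r l m] by auto
  consider "a = 0" "c = 0" | "a = 0" "c \<noteq> 0" | "a \<noteq> 0" "c = a"
    using ac by blast
  then show ?thesis
  proof cases
    case 1
    then have "trias_isomorphic T (line_trias 0 0 0)"
      using r l m ba by (intro iso[where d = 1]) auto
    then show ?thesis by (simp add: Trias_eq_line_trias)
  next
    case 2
    then have "trias_isomorphic T (line_trias 0 0 1)"
      using r l m ba by (intro iso[where d = c]) auto
    then show ?thesis by (simp add: Trias_eq_line_trias)
  next
    case 3
    then have "trias_isomorphic T (line_trias 1 1 1)"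
      using r l m ba by (intro iso[where d = a]) auto
    then show ?thesis by (simp add: Trias_eq_line_trias)
  qed
qed

section \<open>Isomorphism invariants\<close>

text \<open>
  The image of \<open>1\<close> under an isomorphism \<open>f\<close> is nonzero, and \<open>f (a) = f (1 \<turnstile> 1) = a' (f 1)\<^sup>2\<close>; hence
  \<open>a\<close> and \<open>a'\<close> vanish together, and likewise for the constants of the other two products.
\<close>
lemma isomorphic_line_trias_zero_iff:
  assumes "trias_isomorphic (line_trias a b c) (line_trias a' b' c')"
  shows "a = 0 \<longleftrightarrow> a' = 0" and "b = 0 \<longleftrightarrow> b' = 0" and "c = 0 \<longleftrightarrow> c' = 0"
proof -
  obtain f where iso: "trias_iso (line_trias a b c) (line_trias a' b' c') f"
    using assms unfolding trias_isomorphic_def by blast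
  then have scale: "f (z * x) = z * f x" for z x
    by (simp add: trias_iso_def line_trias_def Vector_Spaces.linear_iff)
  have inj: "inj f"
    using iso by (simp add: trias_iso_def bij_is_inj)
  have f0: "f 0 = 0"
    using scale[of 0 0] by simp
  then have f_eq_0: "f z = 0 \<longleftrightarrow> z = 0" for z
    using inj_eq[OF inj, of z 0] by simp
  have "f (a * (1 * 1)) = a' * (f 1 * f 1)" "f (b * (1 * 1)) = b' * (f 1 * f 1)"
    "f (c * (1 * 1)) = c' * (f 1 * f 1)"
    using iso unfolding trias_iso_def line_trias_def trias.simps by blast+
  then show "a = 0 \<longleftrightarrow> a' = 0" and "b = 0 \<longleftrightarrow> b' = 0" and "c = 0 \<longleftrightarrow> c' = 0"
    using f_eq_0[of 1] f_eq_0[of a] f_eq_0[of b] f_eq_0[of c] by simp_all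
qed

theorem theorem3p1:
  fixes T :: "'a::ab_group_add trias"
  assumes "triassociative_algebra T" and "trias_dim T = 1"
  shows "(trias_isomorphic T Trias_1_1 \<or> trias_isomorphic T Trias_1_2 \<or> trias_isomorphic T Trias_1_3)
    \<and> triassociative_algebra Trias_1_1 \<and> trias_basis Trias_1_1 {1}
    \<and> triassociative_algebra Trias_1_2 \<and> trias_basis Trias_1_2 {1}
    \<and> triassociative_algebra Trias_1_3 \<and> trias_basis Trias_1_3 {1}
    \<and> \<not> trias_isomorphic Trias_1_1 Trias_1_2
    \<and> \<not> trias_isomorphic Trias_1_1 Trias_1_3
    \<and> \<not> trias_isomorphic Trias_1_2 Trias_1_3"
proof (intro conjI)
  show "trias_isomorphic T Trias_1_1 \<or> trias_isomorphic T Trias_1_2 \<or> trias_isomorphic T Trias_1_3"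
    using one_dimensional_classification[OF assms] .
qed (auto simp: Trias_eq_line_trias triassociative_line_trias trias_basis_line_trias
    dest: isomorphic_line_trias_zero_iff)

end
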